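(* Let $\mathcal{N}$ be an $s\times s$ (zero-nonzero) pattern. If $m\geq 3$ and $\mathcal{N}$ is potentially nilpotent, then $\mathcal{C}_m(\mathcal{N})$ is potentially nilpotent. In fact, if (with $m\ge 3$) $\mathcal{N}$ allows index $k$, then $\mathcal{C}_m(\mathcal{N})$ allows index $r$ for some $r\leq 3k$.
   Context: A (zero-nonzero) pattern of order $n$ is an $n\times n$ matrix $\mathcal{A}$ with entries in $\{*,0\}$, and $Q(\mathcal{A})=\{A\in M_n(\mathbb{R}) : A_{i,j}\neq 0 \Leftrightarrow \mathcal{A}_{i,j}=* \text{ for all } i,j\}$. A pattern $\mathcal{A}$ is potentially nilpotent if $Q(\mathcal{A})$ contains a nilpotent matrix. The index of a nilpotent matrix $N$ is the smallest positive integer $k$ with $N^k=0$. A pattern $\mathcal{A}$ allows index $k$ if some nilpotent matrix in $Q(\mathcal{A})$ has index $k$. For an $s\times s$ pattern $\mathcal{N}$, $\mathcal{C}_m(\mathcal{N})$ is the $ms\times ms$ pattern given in block form by $$\mathcal{C}_m(\mathcal{N})=\begin{bmatrix} \mathcal{N} & \mathcal{L} & \cdots & \cdots & \mathcal{L}\\ \mathcal{L} & \mathcal{N} & 0 & \cdots & 0\\ \mathcal{L} & 0 & \ddots & \ddots & \vdots\\ \vdots & \vdots & \ddots & \ddots & 0\\ \mathcal{L} & 0 & \cdots & 0 & \mathcal{N}\end{bmatrix},$$ with $m$ diagonal blocks $\mathcal{N}$, where $\mathcal{L}$ is the $s\times s$ pattern whose $(1,1)$ entry is $*$ and all of whose other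 entries are $0$. *)

theory Defs
  imports Complex_Main "Jordan_Normal_Form.Matrix"
begin

datatype pattern_entry = Star | Zero

type_synonym pattern = "pattern_entry mat"

definition qualitative_class :: "pattern \<Rightarrow> real mat set" where
  "qualitative_class P =
     {A \<in> carrier_mat (dim_row P) (dim_col P).
        \<forall>i < dim_row P. \<forall>j < dim_col P. A $$ (i, j) \<noteq> 0 \<longleftrightarrow> P $$ (i, j) = Star}"

definition nilpotent_mat :: "real mat \<Rightarrow> bool" where
  "nilpotent_mat A \<longleftrightarrow>
     square_mat A \<and> (\<exists>k > 0. A ^\<^sub>m k = 0\<^sub>m (dim_row A) (dim_row A))"

text \<open>Only meaningful for nilpotent matrices.\<close>

definition nilpotency_index :: "real mat \<Rightarrow> nat" where
  "nilpotency_index A = (LEAST k. k > 0 \<and> A ^\<^sub>m k = 0\<^sub>m (dim_row A) (dim_row A))"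

definition potentially_nilpotent :: "pattern \<Rightarrow> bool" where
  "potentially_nilpotent P \<longleftrightarrow> (\<exists>A \<in> qualitative_class P. nilpotent_mat A)"

definition allows_index :: "pattern \<Rightarrow> nat \<Rightarrow> bool" where
  "allows_index P k \<longleftrightarrow>
     (\<exists>A \<in> qualitative_class P. nilpotent_mat A \<and> nilpotency_index A = k)"

text \<open>Rows and columns of \<^typ>\<open>'a mat\<close> are numbered from 0, so the
  \<open>(1,1)\<close> entry of the usual notation is the entry at \<open>(0,0)\<close>.\<close>

definition corner_pattern :: "nat \<Rightarrow> pattern" where
  "corner_pattern s = mat s s (\<lambda>(i, j). if i = 0 \<and> j = 0 then Star else Zero)"

definition block_of_C :: "pattern \<Rightarrow> nat \<Rightarrow> nat \<Rightarrow> pattern" where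
  "block_of_C N p q =
     (if p = q then N
      else if p = 0 \<or> q = 0 then corner_pattern (dim_row N)
      else mat (dim_row N) (dim_row N) (\<lambda>_. Zero))"

text \<open>For an \<open>s \<times> s\<close> pattern \<open>N\<close>, entry \<open>(i, j)\<close> of \<open>C\<^sub>m(N)\<close> is entry
  \<open>(i mod s, j mod s)\<close> of the block in block row \<open>i div s\<close> and block column
  \<open>j div s\<close>.\<close>

definition C_pattern :: "nat \<Rightarrow> pattern \<Rightarrow> pattern" where
  "C_pattern m N =
     (let s = dim_row N in
      mat (m * s) (m * s)
        (\<lambda>(i, j). block_of_C N (i div s) (j div s) $$ (i mod s, j mod s)))"

end

theory Submission
  imports Defs
begin

text \<open>
  Let \<open>A\<close> be a nilpotent realisation of \<open>N\<close> with \<open>A\<^sup>k = 0\<close>.  The pattern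
  \<open>C\<^sub>m(N)\<close> has the realisation \<open>M = I \<otimes> A + S \<otimes> E\<close>, where \<open>E\<close> is the matrix
  unit at \<open>(0, 0)\<close> and \<open>S\<close> is a weighted star, a matrix supported on its first
  row and column off the diagonal.  A star with first row \<open>v\<close> and first column
  \<open>u\<close> satisfies \<open>S\<^sup>3 = 0\<close> as soon as \<open>v \<cdot> u = 0\<close>.  A star with a
  single leaf and nonzero weights violates this condition, but with two or more
  leaves the products of the weights can cancel; this is where \<open>m \<ge> 3\<close> enters.

  It remains to see \<open>M\<^bsup>3k\<^esup> = 0\<close>.  Put \<open>X = I \<otimes> A\<close>, \<open>T = S \<otimes> I\<close> and
  \<open>Z = I \<otimes> E\<close>, so that \<open>M = X + T Z\<close>.  Although \<open>X\<close> and \<open>Z\<close> need not commute,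
  \<open>T\<close> commutes with both.  Expanding \<open>(X + T Z)\<^sup>k\<close>, every term other than
  \<open>X\<^sup>k = 0\<close> contains a factor \<open>T\<close>, which can be pulled to the front; hence
  \<open>M\<^sup>k = T W\<close> with \<open>W\<close> commuting with \<open>T\<close>, and \<open>M\<^bsup>3k\<^esup> = T\<^sup>3 W\<^sup>3 = 0\<close>.  The ring
  identity is \<open>nilpotent_add_commuting_multiple\<close>, and the Kronecker product
  rule \<open>kron_mult\<close> supplies the commutation relations.
\<close>

section \<open>Perturbing a nilpotent element by a multiple of a commuting nilpotent\<close>

text \<open>
  Expanding the power, each term but the first contains a factor \<open>T\<close>; as \<open>T\<close>
  commutes with \<open>X\<close> and \<open>Z\<close>, it can be collected on the left.  That the
  cofactor \<open>W\<close> again commutes with \<open>T\<close> is what makes powers of \<open>T W\<close>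
  computable.
\<close>

lemma (in ring) add_commuting_multiple_pow:
  assumes X: "X \<in> carrier R" and T: "T \<in> carrier R" and Z: "Z \<in> carrier R"
    and TX: "T \<otimes> X = X \<otimes> T" and TZ: "T \<otimes> Z = Z \<otimes> T"
  shows "\<exists>W \<in> carrier R. T \<otimes> W = W \<otimes> T \<and>
    (X \<oplus> T \<otimes> Z) [^] (k::nat) = X [^] k \<oplus> T \<otimes> W"
proof (induction k)
  case 0
  show ?case
    by (rule bexI[of _ \<zero>]) (use T in auto)
next
  case (Suc k)
  then obtain W where W: "W \<in> carrier R" and TW: "T \<otimes> W = W \<otimes> T"
    and eq: "(X \<oplus> T \<otimes> Z) [^] k = X [^] k \<oplus> T \<otimes> W"
    by blast
  define Y where "Y = X \<oplus> T \<otimes> Z"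
  define P where "P = X [^] k"
  have Y: "Y \<in> carrier R" and P: "P \<in> carrier R"
    using X T Z by (auto simp: Y_def P_def)
  have TY: "T \<otimes> Y = Y \<otimes> T"
  proof -
    have "T \<otimes> (T \<otimes> Z) = (T \<otimes> Z) \<otimes> T"
      by (metis T Z TZ m_assoc m_closed)
    then show ?thesis
      using X T Z TX by (simp add: Y_def l_distr r_distr)
  qed
  have PT: "T \<otimes> P = P \<otimes> T"
    unfolding P_def by (metis X T TX group_commutes_pow)
  have TPZ: "T \<otimes> (P \<otimes> Z) = (P \<otimes> Z) \<otimes> T"
    by (metis P T Z PT TZ m_assoc)
  have TWY: "T \<otimes> (W \<otimes> Y) = (W \<otimes> Y) \<otimes> T"
    by (metis W T Y TW TY m_assoc)
  have PTZ: "P \<otimes> (T \<otimes> Z) = T \<otimes> (P \<otimes> Z)"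
    by (metis P T Z PT m_assoc)
  have "(X \<oplus> T \<otimes> Z) [^] Suc k = (P \<oplus> T \<otimes> W) \<otimes> Y"
    by (simp add: eq P_def Y_def)
  also have "\<dots> = P \<otimes> X \<oplus> (T \<otimes> (P \<otimes> Z) \<oplus> T \<otimes> (W \<otimes> Y))"
  proof -
    have "P \<otimes> Y = P \<otimes> X \<oplus> T \<otimes> (P \<otimes> Z)"
      using P X T Z by (simp add: Y_def r_distr PTZ)
    then show ?thesis
      using P W Y X T Z by (simp add: l_distr m_assoc a_assoc)
  qed
  also have "\<dots> = X [^] Suc k \<oplus> T \<otimes> (P \<otimes> Z \<oplus> W \<otimes> Y)"
    using P W Y T Z by (simp add: r_distr P_def)
  finally have "(X \<oplus> T \<otimes> Z) [^] Suc k = X [^] Suc k \<oplus> T \<otimes> (P \<otimes> Z \<oplus> W \<otimes> Y)" .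
  moreover have "T \<otimes> (P \<otimes> Z \<oplus> W \<otimes> Y) = (P \<otimes> Z \<oplus> W \<otimes> Y) \<otimes> T"
    using P W Y T Z by (simp add: l_distr r_distr TPZ TWY)
  ultimately show ?case
    using P W Y Z by (intro bexI[of _ "P \<otimes> Z \<oplus> W \<otimes> Y"]) auto
qed

lemma (in ring) nilpotent_add_commuting_multiple:
  assumes X: "X \<in> carrier R" and T: "T \<in> carrier R" and Z: "Z \<in> carrier R"
    and TX: "T \<otimes> X = X \<otimes> T" and TZ: "T \<otimes> Z = Z \<otimes> T"
    and Xk: "X [^] (k::nat) = \<zero>" and Tl: "T [^] (l::nat) = \<zero>"
  shows "(X \<oplus> T \<otimes> Z) [^] (k * l) = \<zero>"
proof -
  obtain W where W: "W \<in> carrier R" and TW: "T \<otimes> W = W \<otimes> T"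
    and eq: "(X \<oplus> T \<otimes> Z) [^] k = X [^] k \<oplus> T \<otimes> W"
    using add_commuting_multiple_pow[OF X T Z TX TZ] by blast
  have "(X \<oplus> T \<otimes> Z) [^] (k * l) = (T \<otimes> W) [^] l"
    using X T Z W by (simp add: nat_pow_pow[symmetric] eq Xk)
  also have "\<dots> = T [^] l \<otimes> W [^] l"
    using T W TW by (intro pow_mult_distrib)
  finally show ?thesis
    using W by (simp add: Tl)
qed

section \<open>Kronecker products\<close>

definition kron :: "'a :: semiring_0 mat \<Rightarrow> 'a mat \<Rightarrow> 'a mat" where
  "kron A B = mat (dim_row A * dim_row B) (dim_col A * dim_col B)
     (\<lambda>(i, j). A $$ (i div dim_row B, j div dim_col B) * B $$ (i mod dim_row B, j mod dim_col B))"

lemma kron_carrier [simp]: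
  assumes "A \<in> carrier_mat a b" "B \<in> carrier_mat c d"
  shows "kron A B \<in> carrier_mat (a * c) (b * d)"
  using assms by (auto simp: kron_def)

lemma div_mod_less_mult:
  fixes i m s :: nat
  assumes "i < m * s"
  shows "i div s < m" "i mod s < s"
proof -
  have "0 < s"
    using assms by (cases s) auto
  then show "i div s < m" "i mod s < s"
    using assms by (auto simp: less_mult_imp_div_less)
qed

lemma kron_index:
  assumes "A \<in> carrier_mat a b" "B \<in> carrier_mat c d" "i < a * c" "j < b * d"
  shows "kron A B $$ (i, j) = A $$ (i div c, j div d) * B $$ (i mod c, j mod d)"
  using assms by (auto simp: kron_def)

lemma sum_div_mod:
  fixes g :: "nat \<Rightarrow> nat \<Rightarrow> 'a :: comm_monoid_add"
  shows "(\<Sum>i<m * s. g (i div s) (i mod s)) = (\<Sum>p<m. \<Sum>q<s. g p q)"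
proof -
  have "(\<Sum>p<m. \<Sum>q<s. g p q) = (\<Sum>(p, q)\<in>{..<m} \<times> {..<s}. g p q)"
    by (simp add: sum.cartesian_product)
  also have "\<dots> = (\<Sum>i<m * s. g (i div s) (i mod s))"
  proof (rule sum.reindex_bij_witness[where i = "\<lambda>i. (i div s, i mod s)"
        and j = "\<lambda>(p, q). p * s + q"])
    fix x assume x: "x \<in> {..<m} \<times> {..<s}"
    then obtain p q where pq: "x = (p, q)" "p < m" "q < s"
      by auto
    have "p * s + q < Suc p * s"
      using pq by simp
    also have "\<dots> \<le> m * s"
      using pq by (intro mult_right_mono) auto
    finally show "(case x of (p, q) \<Rightarrow> p * s + q) \<in> {..<m * s}"
      by (simp add: pq)
  qed (auto dest: div_mod_less_mult)
  finally show ?thesis by simp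
qed

lemma kron_mult:
  fixes A B C D :: "'a :: comm_semiring_0 mat"
  assumes A: "A \<in> carrier_mat a b" and C: "C \<in> carrier_mat b c"
    and B: "B \<in> carrier_mat p q" and D: "D \<in> carrier_mat q r"
  shows "kron A B * kron C D = kron (A * C) (B * D)"
proof (rule eq_matI)
  have AC: "A * C \<in> carrier_mat a c" and BD: "B * D \<in> carrier_mat p r"
    using assms by auto
  have dims: "dim_row (kron A B) = a * p" "dim_col (kron A B) = b * q"
    "dim_row (kron C D) = b * q" "dim_col (kron C D) = c * r"
    "dim_row (kron (A * C) (B * D)) = a * p" "dim_col (kron (A * C) (B * D)) = c * r"
    using kron_carrier[OF A B] kron_carrier[OF C D] kron_carrier[OF AC BD] by auto
  fix i j
  assume "i < dim_row (kron (A * C) (B * D))" "j < dim_col (kron (A * C) (B * D))"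
  then have i: "i < a * p" and j: "j < c * r"
    by (simp_all add: dims)
  note ij = div_mod_less_mult[OF i] div_mod_less_mult[OF j]
  have "(kron A B * kron C D) $$ (i, j) =
      (\<Sum>l<b * q. kron A B $$ (i, l) * kron C D $$ (l, j))"
    using i j by (simp add: scalar_prod_def dims lessThan_atLeast0)
  also have "\<dots> = (\<Sum>l<b * q. A $$ (i div p, l div q) * B $$ (i mod p, l mod q) *
      (C $$ (l div q, j div r) * D $$ (l mod q, j mod r)))"
    using i j by (intro sum.cong refl) (simp add: kron_index[OF A B] kron_index[OF C D])
  also have "\<dots> = (\<Sum>x<b. \<Sum>y<q. A $$ (i div p, x) * B $$ (i mod p, y) *
      (C $$ (x, j div r) * D $$ (y, j mod r)))"
    by (rule sum_div_mod)
  also have "\<dots> = (\<Sum>x<b. A $$ (i div p, x) * C $$ (x, j div r)) *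
      (\<Sum>y<q. B $$ (i mod p, y) * D $$ (y, j mod r))"
    by (simp add: sum_product mult_ac)
  also have "\<dots> = (A * C) $$ (i div p, j div r) * (B * D) $$ (i mod p, j mod r)"
    using A B C D ij by (simp add: scalar_prod_def lessThan_atLeast0)
  also have "\<dots> = kron (A * C) (B * D) $$ (i, j)"
    using i j by (simp add: kron_index[OF AC BD])
  finally show "(kron A B * kron C D) $$ (i, j) = kron (A * C) (B * D) $$ (i, j)" .
qed (use assms in \<open>auto simp: kron_def\<close>)

lemma kron_one: "kron (1\<^sub>m m) (1\<^sub>m s) = (1\<^sub>m (m * s) :: 'a :: semiring_1 mat)"
proof (rule eq_matI)
  fix i j assume "i < dim_row (1\<^sub>m (m * s) :: 'a mat)" "j < dim_col (1\<^sub>m (m * s) :: 'a mat)"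
  then have i: "i < m * s" and j: "j < m * s"
    by auto
  have "i = j \<longleftrightarrow> i div s = j div s \<and> i mod s = j mod s"
    by (metis div_mult_mod_eq)
  then show "kron (1\<^sub>m m) (1\<^sub>m s) $$ (i, j) = (1\<^sub>m (m * s) :: 'a mat) $$ (i, j)"
    using i j div_mod_less_mult[OF i] div_mod_less_mult[OF j]
    by (auto simp: kron_def)
qed (auto simp: kron_def)

lemma kron_zero_left: "B \<in> carrier_mat p q \<Longrightarrow> kron (0\<^sub>m a b) B = 0\<^sub>m (a * p) (b * q)"
  by (rule eq_matI) (auto simp: kron_def div_mod_less_mult)

lemma kron_zero_right: "A \<in> carrier_mat a b \<Longrightarrow> kron A (0\<^sub>m p q) = 0\<^sub>m (a * p) (b * q)"
  by (rule eq_matI) (auto simp: kron_def div_mod_less_mult)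

lemma kron_pow:
  fixes A B :: "'a :: comm_semiring_1 mat"
  assumes A: "A \<in> carrier_mat m m" and B: "B \<in> carrier_mat s s"
  shows "kron A B ^\<^sub>m k = kron (A ^\<^sub>m k) (B ^\<^sub>m k)"
proof (induction k)
  case 0
  show ?case
    using A B by (simp add: carrier_matD[OF kron_carrier[OF A B]] kron_one)
next
  case (Suc k)
  then show ?case
    using A B by (simp add: kron_mult[of _ m m _ m _ s s _ s])
qed

section \<open>Weighted stars\<close>

definition star_mat :: "nat \<Rightarrow> (nat \<Rightarrow> 'a) \<Rightarrow> (nat \<Rightarrow> 'a) \<Rightarrow> 'a :: semiring_0 mat" where
  "star_mat m v u = mat m m (\<lambda>(i, j).
     if i = 0 \<and> j = 0 then 0 else if i = 0 then v j else if j = 0 then u i else 0)"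

lemma star_mat_carrier [simp]: "star_mat m v u \<in> carrier_mat m m"
  by (simp add: star_mat_def)

text \<open>
  In block form with the centre split off, the star is \<open>[0, v; u, 0]\<close>, so its
  square is \<open>[v \<cdot> u, 0; 0, u v]\<close>.  When \<open>v \<cdot> u = 0\<close> only the block
  \<open>u v\<close> is left, and multiplying it by the star once more produces the factor
  \<open>v \<cdot> u\<close> again.
\<close>

lemma star_mat_pow_3:
  fixes u v :: "nat \<Rightarrow> 'a :: comm_semiring_1"
  assumes vu: "(\<Sum>q\<in>{1..<m}. v q * u q) = 0"
  shows "star_mat m v u ^\<^sub>m 3 = 0\<^sub>m m m"
proof (cases "m = 0")
  case False
  define S where "S = star_mat m v u"
  have S: "S \<in> carrier_mat m m"
    by (simp add: S_def)
  have entry: "S $$ (i, j) =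
      (if i = 0 \<and> j = 0 then 0 else if i = 0 then v j else if j = 0 then u i else 0)"
    if "i < m" "j < m" for i j
    using that by (simp add: S_def star_mat_def)
  have split: "(\<Sum>l\<in>{0..<m}. f l) = f 0 + (\<Sum>l\<in>{1..<m}. f l)" for f :: "nat \<Rightarrow> 'a"
    using False by (simp add: sum.atLeast_Suc_lessThan)
  define Q :: "'a mat" where "Q = mat m m (\<lambda>(i, j). if i = 0 \<or> j = 0 then 0 else u i * v j)"
  have Q: "Q \<in> carrier_mat m m"
    by (simp add: Q_def)
  have SS: "S * S = Q"
  proof (rule eq_matI)
    fix i j assume "i < dim_row Q" "j < dim_col Q"
    then have ij: "i < m" "j < m" using Q by auto
    have "(S * S) $$ (i, j) = (\<Sum>l\<in>{0..<m}. S $$ (i, l) * S $$ (l, j))"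
      using S ij by (simp add: scalar_prod_def)
    also have "\<dots> = S $$ (i, 0) * S $$ (0, j) + (\<Sum>l\<in>{1..<m}. S $$ (i, l) * S $$ (l, j))"
      by (rule split)
    also have "(\<Sum>l\<in>{1..<m}. S $$ (i, l) * S $$ (l, j)) =
        (\<Sum>l\<in>{1..<m}. if i = 0 \<and> j = 0 then v l * u l else 0)"
      using ij by (intro sum.cong) (auto simp: entry)
    also have "\<dots> = 0"
      using vu by (cases "i = 0 \<and> j = 0") auto
    finally show "(S * S) $$ (i, j) = Q $$ (i, j)"
      using ij by (simp add: entry Q_def)
  qed (use S Q in auto)
  have "Q * S = 0\<^sub>m m m"
  proof (rule eq_matI)
    fix i j assume "i < dim_row (0\<^sub>m m m :: 'a mat)" "j < dim_col (0\<^sub>m m m :: 'a mat)"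
    then have ij: "i < m" "j < m" by auto
    have "(Q * S) $$ (i, j) = (\<Sum>l\<in>{0..<m}. Q $$ (i, l) * S $$ (l, j))"
      using S Q ij by (simp add: scalar_prod_def)
    also have "\<dots> = Q $$ (i, 0) * S $$ (0, j) + (\<Sum>l\<in>{1..<m}. Q $$ (i, l) * S $$ (l, j))"
      by (rule split)
    also have "(\<Sum>l\<in>{1..<m}. Q $$ (i, l) * S $$ (l, j)) =
        (\<Sum>l\<in>{1..<m}. (if i = 0 \<or> j \<noteq> 0 then 0 else u i) * (v l * u l))"
      using ij by (intro sum.cong) (auto simp: entry Q_def mult_ac)
    also have "\<dots> = 0"
      using vu by (simp add: sum_distrib_left[symmetric])
    finally show "(Q * S) $$ (i, j) = 0\<^sub>m m m $$ (i, j)"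
      using ij by (simp add: Q_def)
  qed (use S Q in auto)
  then show ?thesis
    using S by (simp add: numeral_3_eq_3 SS flip: S_def)
qed (rule eq_matI, auto simp: star_mat_def)

section \<open>The realisation of the composed pattern\<close>

text \<open>
  The leaf weights are \<open>1\<close> in the first row and \<open>2 - m, 1, \<dots>, 1\<close> in the first
  column; these are orthogonal because there are \<open>m - 1\<close> leaves, and nonzero
  because \<open>m \<noteq> 2\<close>.
\<close>

lemma nilpotent_star_exists:
  assumes "m \<ge> 3"
  shows "\<exists>S \<in> carrier_mat m m. S ^\<^sub>m 3 = 0\<^sub>m m m \<and>
    (\<forall>p<m. \<forall>q<m. S $$ (p, q) \<noteq> (0::real) \<longleftrightarrow> p \<noteq> q \<and> (p = 0 \<or> q = 0))"
proof -
  define u :: "nat \<Rightarrow> real" where "u q = (if q = 1 then 2 - real m else 1)" for q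
  define S where "S = star_mat m (\<lambda>_. 1) u"
  have "(\<Sum>q\<in>{1..<m}. 1 * u q) = u 1 + (\<Sum>q\<in>{2..<m}. u q)"
    using assms by (simp add: sum.atLeast_Suc_lessThan numeral_2_eq_2)
  also have "(\<Sum>q\<in>{2..<m}. u q) = (\<Sum>q\<in>{2..<m}. 1)"
    by (intro sum.cong) (auto simp: u_def)
  finally have "S ^\<^sub>m 3 = 0\<^sub>m m m"
    using assms unfolding S_def by (intro star_mat_pow_3) (simp add: u_def)
  moreover have "S $$ (p, q) \<noteq> 0 \<longleftrightarrow> p \<noteq> q \<and> (p = 0 \<or> q = 0)" if "p < m" "q < m" for p q
    using that assms by (auto simp: S_def star_mat_def u_def)
  ultimately show ?thesis
    by (intro bexI[of _ S]) (auto simp: S_def)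
qed

text \<open>
  The summands \<open>I \<otimes> A\<close> and \<open>S \<otimes> E\<close> live in different blocks, the diagonal ones
  and the ones joining the centre to a leaf, so no entries cancel and the
  pattern can be read off block by block.
\<close>

lemma C_pattern_realisation:
  assumes N: "N \<in> carrier_mat s s" and m: "m \<ge> 3"
    and A: "A \<in> qualitative_class N" and Ak: "A ^\<^sub>m k = 0\<^sub>m s s"
  shows "\<exists>M \<in> qualitative_class (C_pattern m N). M ^\<^sub>m (3 * k) = 0\<^sub>m (m * s) (m * s)"
proof -
  have Ac: "A \<in> carrier_mat s s"
    and Apat: "\<And>i j. i < s \<Longrightarrow> j < s \<Longrightarrow> A $$ (i, j) \<noteq> 0 \<longleftrightarrow> N $$ (i, j) = Star"
    using A N by (auto simp: qualitative_class_def)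
  obtain S :: "real mat" where S: "S \<in> carrier_mat m m" and S3: "S ^\<^sub>m 3 = 0\<^sub>m m m"
    and Spat: "\<And>p q. p < m \<Longrightarrow> q < m \<Longrightarrow> S $$ (p, q) \<noteq> 0 \<longleftrightarrow> p \<noteq> q \<and> (p = 0 \<or> q = 0)"
    using nilpotent_star_exists[OF m] by blast
  define E :: "real mat" where "E = mat s s (\<lambda>(i, j). if i = 0 \<and> j = 0 then 1 else 0)"
  have E: "E \<in> carrier_mat s s"
    by (simp add: E_def)
  define X where "X = kron (1\<^sub>m m) A"
  define T where "T = kron S (1\<^sub>m s)"
  define Z where "Z = kron (1\<^sub>m m) E"
  have carr: "X \<in> carrier_mat (m * s) (m * s)" "T \<in> carrier_mat (m * s) (m * s)"
    "Z \<in> carrier_mat (m * s) (m * s)"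
    using Ac S E by (simp_all add: X_def T_def Z_def)
  have TZ: "T * Z = kron S E" "Z * T = kron S E"
    using S E by (simp_all add: T_def Z_def kron_mult[of _ m m _ m _ s s _ s])
  have TX: "T * X = X * T"
    using S Ac by (simp add: T_def X_def kron_mult[of _ m m _ m _ s s _ s])
  have Xk: "X ^\<^sub>m k = 0\<^sub>m (m * s) (m * s)"
    using Ac Ak by (simp add: X_def kron_pow[of _ m _ s] kron_zero_right[OF pow_carrier_mat])
  have T3: "T ^\<^sub>m 3 = 0\<^sub>m (m * s) (m * s)"
    using S S3 by (simp add: T_def kron_pow[of _ m _ s] kron_zero_left[OF pow_carrier_mat])
  define M where "M = X + T * Z"
  have M: "M \<in> carrier_mat (m * s) (m * s)"
    using carr by (simp add: M_def)
  have nil: "M ^\<^sub>m (3 * k) = 0\<^sub>m (m * s) (m * s)"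
  proof -
    interpret ring "ring_mat TYPE(real) (m * s) ()"
      by (rule ring_mat)
    note to_ring = pow_mat_ring_pow[where b = "()"]
    show ?thesis
      using nilpotent_add_commuting_multiple[of X T Z k 3] carr TX TZ Xk T3 M
      unfolding to_ring[OF carr(1)] to_ring[OF carr(2)] to_ring[OF M]
      by (simp add: ring_mat_simps M_def mult.commute)
  qed
  have "M \<in> qualitative_class (C_pattern m N)"
  proof -
    have "M $$ (i, j) \<noteq> 0 \<longleftrightarrow> C_pattern m N $$ (i, j) = Star"
      if i: "i < m * s" and j: "j < m * s" for i j
    proof -
      note b = div_mod_less_mult[OF i] div_mod_less_mult[OF j]
      have "M $$ (i, j) = (if i div s = j div s then A $$ (i mod s, j mod s) else 0) +
          S $$ (i div s, j div s) * E $$ (i mod s, j mod s)"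
        using i j b carr S E Ac carrier_matD[OF kron_carrier[OF S E]]
        by (auto simp: M_def TZ X_def kron_index[of _ m m _ s s])
      moreover have "C_pattern m N $$ (i, j) =
          block_of_C N (i div s) (j div s) $$ (i mod s, j mod s)"
        using i j N by (simp add: C_pattern_def)
      ultimately show ?thesis
        using Apat[OF b(2,4)] Spat[OF b(1,3)] b N
        by (auto simp: block_of_C_def corner_pattern_def E_def)
    qed
    moreover have "dim_row (C_pattern m N) = m * s" "dim_col (C_pattern m N) = m * s"
      using N by (simp_all add: C_pattern_def Let_def)
    ultimately show ?thesis
      using M by (auto simp: qualitative_class_def)
  qed
  with nil show ?thesis
    by blast
qed

lemma pow_nilpotency_index:
  assumes "nilpotent_mat A"
  shows "nilpotency_index A > 0"
    and "A ^\<^sub>m nilpotency_index A = 0\<^sub>m (dim_row A) (dim_row A)"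
proof -
  have "\<exists>k. k > 0 \<and> A ^\<^sub>m k = 0\<^sub>m (dim_row A) (dim_row A)"
    using assms by (auto simp: nilpotent_mat_def)
  then have "nilpotency_index A > 0 \<and> A ^\<^sub>m nilpotency_index A = 0\<^sub>m (dim_row A) (dim_row A)"
    unfolding nilpotency_index_def by (rule LeastI_ex)
  then show "nilpotency_index A > 0"
    and "A ^\<^sub>m nilpotency_index A = 0\<^sub>m (dim_row A) (dim_row A)"
    by auto
qed

lemma allows_index_C_pattern:
  assumes N: "N \<in> carrier_mat s s" and m: "m \<ge> 3" and k: "allows_index N k"
  shows "\<exists>r \<le> 3 * k. allows_index (C_pattern m N) r"
proof -
  obtain A where A: "A \<in> qualitative_class N" "nilpotent_mat A" "nilpotency_index A = k"
    using k by (auto simp: allows_index_def)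
  have "dim_row A = s"
    using A(1) N by (auto simp: qualitative_class_def)
  then have "k > 0" and Ak: "A ^\<^sub>m k = 0\<^sub>m s s"
    using pow_nilpotency_index[OF A(2)] A(3) by auto
  obtain M where M: "M \<in> qualitative_class (C_pattern m N)"
    and Mk: "M ^\<^sub>m (3 * k) = 0\<^sub>m (m * s) (m * s)"
    using C_pattern_realisation[OF N m A(1) Ak] by blast
  have Mc: "M \<in> carrier_mat (m * s) (m * s)"
    using M N by (auto simp: qualitative_class_def C_pattern_def Let_def)
  have *: "3 * k > 0 \<and> M ^\<^sub>m (3 * k) = 0\<^sub>m (dim_row M) (dim_row M)"
    using \<open>k > 0\<close> Mk Mc by auto
  then have "nilpotent_mat M"
    using Mc unfolding nilpotent_mat_def by (intro conjI exI[of _ "3 * k"]) auto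
  moreover have "nilpotency_index M \<le> 3 * k"
    unfolding nilpotency_index_def using * by (rule Least_le)
  ultimately show ?thesis
    using M by (auto simp: allows_index_def)
qed

theorem theorem3p2:
  fixes N :: pattern and s m :: nat
  assumes "s \<ge> 1"
    and "N \<in> carrier_mat s s"
    and "m \<ge> 3"
  shows "(potentially_nilpotent N \<longrightarrow> potentially_nilpotent (C_pattern m N)) \<and>
         (\<forall>k. allows_index N k \<longrightarrow> (\<exists>r \<le> 3 * k. allows_index (C_pattern m N) r))"
proof -
  \<comment> \<open>Every nilpotent matrix has an index, so the first claim follows from the second.\<close>
  have "potentially_nilpotent P \<longleftrightarrow> (\<exists>k. allows_index P k)" for P
    by (auto simp: potentially_nilpotent_def allows_index_def)
  then show ?thesis
    using allows_index_C_pattern[OF assms(2,3)] by blast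
qed

end
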